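(* Let $d \ge 0$ be an integer and let $\mathbf v = \{v_1,\dots,v_n\}$ be a multiset of integers such that $\mathbb P_1(\mathbf v) > 2^{-d-1}$. Then $\mathbf v$ contains a sub-multiset $\mathbf w$ of size at most $d$ such that the cube $S(\mathbf w)$ contains all of $v_1,\dots,v_n$.
   Context: For a multiset $\mathbf v=\{v_1,\dots,v_n\}$ of integers, $\mathbb P_1(\mathbf v) := \max_{a\in\mathbb Z} \mathbf P(\eta_1 v_1+\dots+\eta_n v_n = a)$, where $\eta_1,\dots,\eta_n$ are i.i.d. random signs, each equal to $+1$ or $-1$ with probability $1/2$. For a multiset $\mathbf w=\{w_1,\dots,w_r\}$ of real numbers, the cube is $S(\mathbf w) := \{\epsilon_1 w_1+\dots+\epsilon_r w_r : \epsilon_i\in\{-1,0,1\}\}$ (so $S(\emptyset)=\{0\}$). *)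

theory Defs
  imports "HOL-Probability.Probability"
begin

text \<open>
  A multiset \<open>M = {m\<^sub>1, \<dots>, m\<^sub>k}\<close> carries no enumeration of its elements. We therefore index
  the \<open>k\<close> coefficients of a linear combination of its elements by pairs \<open>(x, j)\<close>, where
  \<open>j < count M x\<close>: each occurrence of \<open>x\<close> gets its own coefficient. The lemmas
  \<open>max_conc_prob_enum\<close> and \<open>cube_enum\<close> below give the equivalent descriptions in terms of an
  arbitrary enumeration \<open>(v\<^sub>i)\<close>, \<open>i \<in> I\<close>.
\<close>

definition copies :: "'a multiset \<Rightarrow> ('a \<times> nat) set" where
  "copies M = (SIGMA x:set_mset M. {..<count M x})"

definition random_signs :: "'i set \<Rightarrow> ('i \<Rightarrow> int) pmf" where
  "random_signs I = Pi_pmf I 0 (\<lambda>_. pmf_of_set {-1, 1})"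

text \<open>
  This is \<open>\<bbbP>\<^sub>1\<close>. The range is finite by \<open>finite_range_conc_prob\<close>, so \<open>Max\<close> is meaningful here.
\<close>

definition max_conc_prob :: "int multiset \<Rightarrow> real" where
  "max_conc_prob V = Max (range (\<lambda>a::int.
     measure_pmf.prob (random_signs (copies V)) {\<eta>. (\<Sum>p\<in>copies V. \<eta> p * fst p) = a}))"

definition cube :: "real multiset \<Rightarrow> real set" where
  "cube W = {(\<Sum>p\<in>copies W. \<epsilon> p * fst p) | \<epsilon>. \<forall>p\<in>copies W. \<epsilon> p \<in> {-1, 0, 1}}"


lemma finite_copies [simp]: "finite (copies M)"
  by (simp add: copies_def)

lemma card_copies: "card (copies M) = size M"
  by (simp add: copies_def size_multiset_overloaded_eq)

lemma finite_set_random_signs: "finite I \<Longrightarrow> finite (set_pmf (random_signs I))"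
  unfolding random_signs_def by (subst set_Pi_pmf) auto

lemma finite_range_conc_prob:
  fixes f :: "('i \<Rightarrow> int) \<Rightarrow> int"
  assumes "finite I"
  shows "finite (range (\<lambda>a. measure_pmf.prob (random_signs I) {\<eta>. f \<eta> = a}))"
proof (rule finite_subset)
  let ?p = "\<lambda>a. measure_pmf.prob (random_signs I) {\<eta>. f \<eta> = a}"
  show "range ?p \<subseteq> insert 0 (?p ` f ` set_pmf (random_signs I))"
  proof clarify
    fix a assume "?p a \<notin> ?p ` f ` set_pmf (random_signs I)"
    then have "a \<notin> f ` set_pmf (random_signs I)" by blast
    then show "?p a = 0" by (auto simp: measure_pmf_zero_iff)
  qed
qed (use finite_set_random_signs[OF assms] in auto)

lemma copies_empty [simp]: "copies {#} = {}"
  by (simp add: copies_def)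

lemma copies_add_mset: "copies (add_mset a M) = insert (a, count M a) (copies M)"
  by (auto simp: copies_def not_in_iff split: if_splits)

lemma copies_enum:
  assumes "finite I"
  obtains h where "bij_betw h I (copies (image_mset v (mset_set I)))" "\<And>i. i \<in> I \<Longrightarrow> fst (h i) = v i"
proof -
  have "\<exists>h. bij_betw h I (copies (image_mset v (mset_set I))) \<and> (\<forall>i\<in>I. fst (h i) = v i)"
    using assms
  proof (induction I)
    case (insert x I)
    let ?M = "image_mset v (mset_set I)"
    from insert.IH obtain h where h: "bij_betw h I (copies ?M)" "\<forall>i\<in>I. fst (h i) = v i" by blast
    define g where "g = h(x := (v x, count ?M (v x)))"
    have gx: "g x = (v x, count ?M (v x))" by (simp add: g_def)
    have "g x \<notin> copies ?M" by (simp add: gx copies_def)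
    moreover have "bij_betw g I (copies ?M)"
      using h(1) insert.hyps by (subst bij_betw_cong[where g = h]) (auto simp: g_def)
    ultimately have "bij_betw g (insert x I) (insert (g x) (copies ?M))"
      using insert.hyps notIn_Un_bij_betw[of x I g "copies ?M"] by simp
    moreover have "\<forall>i\<in>insert x I. fst (g i) = v i"
      using h(2) by (simp add: g_def)
    ultimately show ?case
      using insert.hyps by (intro exI[of _ g]) (simp add: copies_add_mset gx)
  qed (auto simp: bij_betw_def)
  then show ?thesis using that by blast
qed

lemma max_conc_prob_enum:
  assumes "finite I"
  shows "max_conc_prob (image_mset v (mset_set I)) =
    Max (range (\<lambda>a. measure_pmf.prob (random_signs I) {\<eta>. (\<Sum>i\<in>I. \<eta> i * v i) = a}))"
proof -
  let ?C = "copies (image_mset v (mset_set I))"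
  from copies_enum[OF assms] obtain h
    where h: "bij_betw h I ?C" "\<And>i. i \<in> I \<Longrightarrow> fst (h i) = v i" by metis
  obtain q where q: "q \<notin> ?C"
    using ex_new_if_finite[OF _ finite_copies] by (metis finite_prod infinite_UNIV_nat)
  define g where "g = (\<lambda>i. if i \<in> I then h i else q)"
  have g: "bij_betw g I ?C" "\<And>i. i \<in> I \<Longrightarrow> fst (g i) = v i"
    using h bij_betw_cong[of I g h ?C] by (auto simp: g_def)
  have "random_signs I = map_pmf (\<lambda>\<eta>. \<eta> \<circ> g) (random_signs ?C)"
    unfolding random_signs_def by (rule Pi_pmf_bij_betw[OF assms g(1)]) (use q in \<open>simp add: g_def\<close>)
  moreover have "(\<Sum>i\<in>I. (\<eta> \<circ> g) i * v i) = (\<Sum>p\<in>?C. \<eta> p * fst p)" for \<eta> :: "int \<times> nat \<Rightarrow> int"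
    using sum.reindex_bij_betw[OF g(1), of "\<lambda>p. \<eta> p * fst p"] g(2) by (simp cong: sum.cong)
  ultimately show ?thesis
    by (simp add: max_conc_prob_def vimage_def)
qed

lemma cube_enum:
  assumes "finite I"
  shows "cube (image_mset w (mset_set I)) =
    {(\<Sum>i\<in>I. \<epsilon> i * w i) | \<epsilon>. \<forall>i\<in>I. \<epsilon> i \<in> {-1, 0, 1}}"
proof -
  let ?C = "copies (image_mset w (mset_set I))"
  from copies_enum[OF assms] obtain h
    where h: "bij_betw h I ?C" "\<And>i. i \<in> I \<Longrightarrow> fst (h i) = w i" by metis
  have sum_eq: "(\<Sum>p\<in>?C. \<epsilon> p * fst p) = (\<Sum>i\<in>I. \<epsilon> (h i) * w i)" for \<epsilon>
    using sum.reindex_bij_betw[OF h(1), of "\<lambda>p. \<epsilon> p * fst p"] h(2) by (simp cong: sum.cong)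
  have mem: "h i \<in> ?C" if "i \<in> I" for i using h(1) that by (auto simp: bij_betw_def)
  show ?thesis
  proof (intro equalityI subsetI)
    fix s assume "s \<in> cube (image_mset w (mset_set I))"
    then obtain \<epsilon> where "\<forall>p\<in>?C. \<epsilon> p \<in> {-1, 0, 1}" "s = (\<Sum>p\<in>?C. \<epsilon> p * fst p)"
      unfolding cube_def by blast
    then show "s \<in> {(\<Sum>i\<in>I. \<epsilon> i * w i) | \<epsilon>. \<forall>i\<in>I. \<epsilon> i \<in> {-1, 0, 1}}"
      using mem unfolding sum_eq by (intro CollectI exI[of _ "\<lambda>i. \<epsilon> (h i)"]) blast
  next
    fix s assume "s \<in> {(\<Sum>i\<in>I. \<epsilon> i * w i) | \<epsilon>. \<forall>i\<in>I. \<epsilon> i \<in> {-1, 0, 1}}"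
    then obtain \<epsilon> where e: "\<forall>i\<in>I. \<epsilon> i \<in> {-1, 0, 1}" "s = (\<Sum>i\<in>I. \<epsilon> i * w i)" by blast
    let ?g = "\<lambda>p. \<epsilon> (inv_into I h p)"
    have "\<forall>p\<in>?C. ?g p \<in> {-1, 0, 1}"
      using e(1) h(1) by (metis bij_betw_imp_surj_on inv_into_into)
    moreover have "s = (\<Sum>p\<in>?C. ?g p * fst p)"
      unfolding sum_eq e(2) using h(1)
      by (intro sum.cong) (auto simp: bij_betw_inv_into_left)
    ultimately show "s \<in> cube (image_mset w (mset_set I))"
      unfolding cube_def by (intro CollectI exI[of _ ?g] conjI)
  qed
qed

end

theory Submission
  imports Defs
begin

text \<open>
  Call integers \<open>w\<^sub>1, \<dots>, w\<^sub>r\<close> dissociated if no nontrivial combination with coefficients in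
  \<open>{-1, 0, 1}\<close> vanishes. Two different sign patterns then never give the same sum
  \<open>\<plusminus>w\<^sub>1 \<plusminus> \<dots> \<plusminus> w\<^sub>r\<close>, because half the difference of the patterns is a vanishing combination.
  So if \<open>\<^bold>v\<close> contains \<open>r\<close> dissociated elements, fixing the signs of all the others leaves at most
  one pattern on these \<open>r\<close> that reaches a given value, and no value has probability above
  \<open>2\<^sup>-\<^sup>r\<close> (\<open>max_conc_prob_le_dissociated\<close>). Under the hypothesis, dissociated sub-multisets
  therefore have at most \<open>d\<close> elements.

  Let \<open>\<^bold>w\<close> be a largest one. An element \<open>v\<close> of \<open>\<^bold>v\<close> outside \<open>S(\<^bold>w)\<close> could be added to it:
  a vanishing combination with coefficient \<open>\<plusminus>1\<close> at \<open>v\<close> could be solved for \<open>v\<close>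
  (\<open>dissociated_add_mset\<close>). The result would still be a sub-multiset of \<open>\<^bold>v\<close>, because the
  elements of \<open>\<^bold>w\<close> lie in \<open>S(\<^bold>w)\<close> and so \<open>v\<close> does not occur in \<open>\<^bold>w\<close>. Since \<open>\<^bold>w\<close> is
  largest, there is no such \<open>v\<close>.
\<close>

definition dissociated_on :: "'i set \<Rightarrow> ('i \<Rightarrow> int) \<Rightarrow> bool" where
  "dissociated_on J v \<longleftrightarrow>
     (\<forall>\<epsilon>. (\<forall>i\<in>J. \<epsilon> i \<in> {-1, 0, 1}) \<longrightarrow> (\<Sum>i\<in>J. \<epsilon> i * v i) = 0 \<longrightarrow> (\<forall>i\<in>J. \<epsilon> i = 0))"

abbreviation dissociated :: "int multiset \<Rightarrow> bool" where
  "dissociated W \<equiv> dissociated_on (copies W) fst"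

lemma image_mset_fst_copies: "image_mset fst (mset_set (copies W)) = W"
proof (induction W)
  case (add a W)
  have "(a, count W a) \<notin> copies W" by (simp add: copies_def)
  with add show ?case by (simp add: copies_add_mset)
qed simp

text \<open>
  The enumeration of \<open>W\<close> by its own copies keeps the coefficients indexed by \<open>copies W\<close> rather
  than by the copies of the image of \<open>W\<close> in the reals.
\<close>

lemma of_int_in_cube_iff:
  "real_of_int a \<in> cube (image_mset real_of_int W) \<longleftrightarrow>
     (\<exists>\<epsilon>. (\<forall>p\<in>copies W. \<epsilon> p \<in> {-1, 0, 1}) \<and> a = (\<Sum>p\<in>copies W. \<epsilon> p * fst p))"
    (is "?L \<longleftrightarrow> ?R")
proof -
  have "image_mset real_of_int W =
      image_mset (\<lambda>p. real_of_int (fst p)) (mset_set (copies W))"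
    using arg_cong[OF image_mset_fst_copies[of W], of "image_mset real_of_int"]
    by (simp add: multiset.map_comp o_def)
  then have L: "?L \<longleftrightarrow> (\<exists>\<epsilon>. (\<forall>p\<in>copies W. \<epsilon> p \<in> {-1, 0, 1 :: real}) \<and>
      real_of_int a = (\<Sum>p\<in>copies W. \<epsilon> p * real_of_int (fst p)))"
    by (auto simp: cube_enum)
  show ?thesis
  proof
    assume ?L
    then obtain \<epsilon> where \<epsilon>: "\<forall>p\<in>copies W. \<epsilon> p \<in> {-1, 0, 1 :: real}"
      "real_of_int a = (\<Sum>p\<in>copies W. \<epsilon> p * real_of_int (fst p))"
      unfolding L by blast
    have "real_of_int \<lfloor>\<epsilon> p\<rfloor> = \<epsilon> p" if "p \<in> copies W" for p
      using \<epsilon>(1) that by fastforce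
    then have "real_of_int a = real_of_int (\<Sum>p\<in>copies W. \<lfloor>\<epsilon> p\<rfloor> * fst p)"
      unfolding \<epsilon>(2) of_int_sum of_int_mult by (intro sum.cong) (simp_all only:)
    then have "a = (\<Sum>p\<in>copies W. \<lfloor>\<epsilon> p\<rfloor> * fst p)"
      by (simp only: of_int_eq_iff)
    moreover have "\<lfloor>x\<rfloor> \<in> {-1, 0, 1}" if "x \<in> {-1, 0, 1}" for x :: real
      using that by (auto simp: floor_minus)
    with \<epsilon>(1) have "\<forall>p\<in>copies W. \<lfloor>\<epsilon> p\<rfloor> \<in> {-1, 0, 1}" by blast
    ultimately show ?R by (intro exI[of _ "\<lambda>p. \<lfloor>\<epsilon> p\<rfloor>"] conjI)
  next
    assume ?R
    then obtain \<epsilon> where \<epsilon>: "\<forall>p\<in>copies W. \<epsilon> p \<in> {-1, 0, 1 :: int}"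
      "a = (\<Sum>p\<in>copies W. \<epsilon> p * fst p)"
      by blast
    then have "\<forall>p\<in>copies W. real_of_int (\<epsilon> p) \<in> {-1, 0, 1}" by fastforce
    with \<epsilon>(2) show ?L
      unfolding L by (intro exI[of _ "\<lambda>p. real_of_int (\<epsilon> p)"]) simp
  qed
qed

lemma of_int_in_cube_member:
  assumes "a \<in># W"
  shows "real_of_int a \<in> cube (image_mset real_of_int W)"
proof -
  let ?\<epsilon> = "\<lambda>p. if p = (a, 0) then 1 else 0 :: int"
  have "(a, 0) \<in> copies W" using assms by (simp add: copies_def)
  then have "(\<Sum>p\<in>copies W. ?\<epsilon> p * fst p) = a"
    by (simp add: if_distrib[of "\<lambda>x. x * _"] cong: if_cong)
  then show ?thesis
    unfolding of_int_in_cube_iff by (intro exI[of _ ?\<epsilon>]) simp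
qed

lemma dissociated_add_mset:
  assumes W: "dissociated W"
    and a: "real_of_int a \<notin> cube (image_mset real_of_int W)"
  shows "dissociated (add_mset a W)"
  unfolding dissociated_on_def
proof (intro allI impI)
  let ?q = "(a, count W a)"
  have q: "?q \<notin> copies W" by (simp add: copies_def)
  fix \<epsilon> assume \<epsilon>: "\<forall>p\<in>copies (add_mset a W). \<epsilon> p \<in> {-1, 0, 1 :: int}"
    and sum0: "(\<Sum>p\<in>copies (add_mset a W). \<epsilon> p * fst p) = 0"
  from sum0 q have rel: "\<epsilon> ?q * a + (\<Sum>p\<in>copies W. \<epsilon> p * fst p) = 0"
    by (simp add: copies_add_mset)
  have \<epsilon>W: "\<forall>p\<in>copies W. \<epsilon> p \<in> {-1, 0, 1}" and \<epsilon>q: "\<epsilon> ?q \<in> {-1, 0, 1}"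
    using \<epsilon> by (auto simp: copies_add_mset)
  have "\<epsilon> ?q = 0"
  proof (rule ccontr)
    \<comment> \<open>\<open>\<epsilon> ?q\<close> is then its own inverse, which solves the relation for \<open>a\<close>.\<close>
    assume "\<epsilon> ?q \<noteq> 0"
    with \<epsilon>q have unit: "\<epsilon> ?q = 1 \<or> \<epsilon> ?q = -1" by auto
    have "a = (\<Sum>p\<in>copies W. (- \<epsilon> ?q * \<epsilon> p) * fst p)"
      using rel unit by (auto simp: sum_negf)
    moreover have "\<forall>p\<in>copies W. - \<epsilon> ?q * \<epsilon> p \<in> {-1, 0, 1}"
      using \<epsilon>W unit by fastforce
    ultimately have "real_of_int a \<in> cube (image_mset real_of_int W)"
      unfolding of_int_in_cube_iff by (intro exI[of _ "\<lambda>p. - \<epsilon> ?q * \<epsilon> p"] conjI)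
    with a show False by contradiction
  qed
  moreover from this rel have "(\<Sum>p\<in>copies W. \<epsilon> p * fst p) = 0" by simp
  with W \<epsilon>W have "\<forall>p\<in>copies W. \<epsilon> p = 0"
    unfolding dissociated_on_def by (elim allE[of _ \<epsilon>] impE)
  ultimately show "\<forall>p\<in>copies (add_mset a W). \<epsilon> p = 0"
    by (simp add: copies_add_mset)
qed

text \<open>
  The signs outside \<open>J\<close> determine a sign pattern with sum \<open>a\<close>, so there are at most
  \<open>2\<^bsup>|I - J|\<^esup>\<close> such patterns among the \<open>2\<^bsup>|I|\<^esup>\<close> equally likely ones.
\<close>

lemma prob_signed_sum_le_dissociated:
  fixes I J :: "'i set"
  assumes fin: "finite I" and J: "J \<subseteq> I" and dis: "dissociated_on J v"
  shows "measure_pmf.prob (random_signs I) {\<eta>. (\<Sum>i\<in>I. \<eta> i * v i) = a} \<le> 1 / 2 ^ card J"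
proof -
  let ?S = "\<lambda>K. PiE_dflt K (0::int) (\<lambda>_. {-1, 1})"
  let ?A = "{\<eta> \<in> ?S I. (\<Sum>i\<in>I. \<eta> i * v i) = a}"
  let ?restr = "\<lambda>\<eta> i. if i \<in> J then 0 else \<eta> i :: int"
  have fin_diff: "finite (I - J)" using fin by simp
  have card_S: "card (?S K) = 2 ^ card K" if "finite K" for K :: "'i set"
    using that by (simp add: card_PiE_dflt numeral_2_eq_2)
  have fin_S: "finite (?S K)" if "finite K" for K :: "'i set"
    using that by (intro finite_PiE_dflt) auto
  have S_ne: "?S I \<noteq> {}"
    using card_S[OF fin] by force

  have "inj_on ?restr ?A"
  proof (rule inj_onI)
    fix \<eta> \<eta>' assume \<eta>: "\<eta> \<in> ?A" and \<eta>': "\<eta>' \<in> ?A" and "?restr \<eta> = ?restr \<eta>'"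
    then have off: "\<eta> i = \<eta>' i" if "i \<notin> J" for i
      using fun_cong[of "?restr \<eta>" "?restr \<eta>'" i] that by simp
    have signs: "\<eta> i \<in> {-1, 1}" "\<eta>' i \<in> {-1, 1}" if "i \<in> J" for i
      using \<eta> \<eta>' J that by (auto simp: PiE_dflt_def)
    define \<epsilon> where "\<epsilon> = (\<lambda>i. (\<eta> i - \<eta>' i) div 2)"
    have half: "2 * \<epsilon> i = \<eta> i - \<eta>' i" and \<epsilon>: "\<epsilon> i \<in> {-1, 0, 1}" if "i \<in> J" for i
      using signs[OF that] by (auto simp: \<epsilon>_def)
    have "2 * (\<Sum>i\<in>J. \<epsilon> i * v i) = (\<Sum>i\<in>J. (\<eta> i - \<eta>' i) * v i)"
      unfolding sum_distrib_left
      by (rule sum.cong) (simp_all only: half mult.assoc[symmetric])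
    also have "\<dots> = (\<Sum>i\<in>I. (\<eta> i - \<eta>' i) * v i)"
      using off by (intro sum.mono_neutral_left[OF fin J]) simp
    also have "\<dots> = 0"
      using \<eta> \<eta>' by (simp add: left_diff_distrib sum_subtractf)
    finally have "(\<Sum>i\<in>J. \<epsilon> i * v i) = 0" by simp
    then have "\<forall>i\<in>J. \<epsilon> i = 0"
      using dis \<epsilon> unfolding dissociated_on_def by blast
    then have "\<eta> i = \<eta>' i" if "i \<in> J" for i
      using half[OF that] that by simp
    with off show "\<eta> = \<eta>'" by blast
  qed
  moreover have "?restr ` ?A \<subseteq> ?S (I - J)"
    by (auto simp: PiE_dflt_def)
  ultimately have "card ?A \<le> card (?S (I - J))"
    using fin_S[OF fin_diff] by (rule card_inj_on_le)
  then have card_A: "real (card ?A) \<le> 2 ^ card (I - J)"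
    unfolding card_S[OF fin_diff] using of_nat_le_iff[where 'a = real] by fastforce

  have "random_signs I = pmf_of_set (?S I)"
    unfolding random_signs_def using fin by (intro Pi_pmf_of_set) auto
  moreover have "?S I \<inter> {\<eta>. (\<Sum>i\<in>I. \<eta> i * v i) = a} = ?A" by auto
  ultimately have "measure_pmf.prob (random_signs I) {\<eta>. (\<Sum>i\<in>I. \<eta> i * v i) = a} =
      real (card ?A) / 2 ^ card I"
    using S_ne fin_S[OF fin] card_S[OF fin] by (simp add: measure_pmf_of_set)
  also have "\<dots> \<le> 2 ^ card (I - J) / 2 ^ card I"
    using card_A by (intro divide_right_mono) auto
  also have "card I = card (I - J) + card J"
    using fin J by (simp add: card_Diff_subset card_mono finite_subset)
  finally show ?thesis by (simp add: power_add)
qed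

lemma copies_mono: "W \<subseteq># V \<Longrightarrow> copies W \<subseteq> copies V"
  unfolding copies_def
  by (intro Sigma_mono set_mset_mono) (auto simp: subseteq_mset_def)

lemma max_conc_prob_le_dissociated:
  assumes "W \<subseteq># V" and "dissociated W"
  shows "max_conc_prob V \<le> 1 / 2 ^ size W"
  unfolding max_conc_prob_def
proof (rule Max.boundedI)
  fix x assume "x \<in> range (\<lambda>a::int.
     measure_pmf.prob (random_signs (copies V)) {\<eta>. (\<Sum>p\<in>copies V. \<eta> p * fst p) = a})"
  then show "x \<le> 1 / 2 ^ size W"
    using prob_signed_sum_le_dissociated[OF finite_copies copies_mono[OF assms(1)] assms(2)]
    by (auto simp: card_copies)
qed (simp_all add: finite_range_conc_prob)

theorem proposition2p3:
  fixes d :: nat and V :: "int multiset"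
  assumes "max_conc_prob V > 1 / 2 ^ (d + 1)"
  shows "\<exists>W. W \<subseteq># V \<and> size W \<le> d \<and>
    (\<forall>v\<in>#V. real_of_int v \<in> cube (image_mset real_of_int W))"
proof -
  let ?P = "\<lambda>W. W \<subseteq># V \<and> dissociated W"
  have size_le: "size W \<le> d" if "?P W" for W
  proof (rule ccontr)
    assume "\<not> size W \<le> d"
    then have "(1::real) / 2 ^ size W \<le> 1 / 2 ^ (d + 1)"
      by (intro divide_left_mono power_increasing) auto
    with max_conc_prob_le_dissociated[of W V] that assms show False by auto
  qed
  have "?P {#}" by (simp add: dissociated_on_def)
  then have "\<exists>W. ?P W \<and> (\<forall>U. ?P U \<longrightarrow> size U \<le> size W)"
  proof (rule Lattices_Big.ex_has_greatest_nat)
    show "\<forall>U. ?P U \<longrightarrow> size U < Suc d" using size_le by (intro allI impI le_imp_less_Suc)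
  qed
  then obtain W where W: "?P W" and largest: "\<And>U. ?P U \<Longrightarrow> size U \<le> size W"
    by metis
  have "real_of_int v \<in> cube (image_mset real_of_int W)" if v: "v \<in># V" for v
  proof (cases "v \<in># W")
    case True
    then show ?thesis by (rule of_int_in_cube_member)
  next
    case False
    with v W have sub: "add_mset v W \<subseteq># V"
      by (simp add: subseteq_mset_def not_in_iff)
    show ?thesis
    proof (rule ccontr)
      assume "real_of_int v \<notin> cube (image_mset real_of_int W)"
      with W sub have "?P (add_mset v W)" by (intro conjI dissociated_add_mset) simp_all
      from largest[OF this] show False by simp
    qed
  qed
  with W size_le show ?thesis by blast
qed

end
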